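(* The sets $\mathcal{D}_{\mathrm{div}} = \{ x \in [0,1] : \sum_{n \in \mathbb{N}} 1/d_n(x) \text{ diverges} \}$ and $\mathcal{T}_{\mathrm{div}} = \{ x \in [0,1] : \sum_{n \in \mathbb{N}} T^n(x) \text{ diverges} \}$ have Hausdorff dimension $0$.
   Context: Pierce digits. For $x \in [0,1]$, define $d_1(x) := \lfloor 1/x \rfloor$ and $T(x) := 1 - d_1(x)\,x$ if $x \neq 0$, and $d_1(0) := \infty$, $T(0) := 0$. Here $\lfloor y \rfloor$ is the largest integer not exceeding $y$. For $n \in \mathbb{N} = \{1,2,3,\dots\}$ put $d_n(x) := d_1(T^{n-1}(x))$, where $T^{k}$ denotes the $k$-fold iterate of $T$ ($T^0$ is the identity). The sequence $(d_n(x))_{n \in \mathbb{N}}$ is the Pierce expansion digit sequence of $x$. Convention: $c/\infty := 0$ for $c \in \mathbb{R}$. Hausdorff dimension is the usual one: for non-empty $F \subseteq [0,1]$ it is $\inf\{ t \geq 0 : \mathcal{H}^t(F) = 0 \}$, with $\mathcal{H}^t$ the $t$-dimensional Hausdorff measure. *)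

theory Defs
  imports "HOL-Analysis.Analysis"
begin

section \<open>Pierce expansions\<close>

definition pierce_d1 :: "real \<Rightarrow> enat" where
  "pierce_d1 x = (if x = 0 then \<infinity> else enat (nat \<lfloor>1 / x\<rfloor>))"

definition pierce_T :: "real \<Rightarrow> real" where
  "pierce_T x = (if x = 0 then 0 else 1 - real (the_enat (pierce_d1 x)) * x)"

text \<open>Digits are numbered from 1; the value at index 0 is irrelevant.\<close>

definition pierce_digit :: "nat \<Rightarrow> real \<Rightarrow> enat" where
  "pierce_digit n x = pierce_d1 ((pierce_T ^^ (n - 1)) x)"

definition recip_enat :: "enat \<Rightarrow> real" where
  "recip_enat d = (case d of enat k \<Rightarrow> 1 / real k | \<infinity> \<Rightarrow> 0)"

text \<open>Library series start at 0, so the index is shifted to let the sums run over n = 1, 2, 3, ...\<close>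

definition D_div :: "real set" where
  "D_div = {x \<in> {0..1}. \<not> summable (\<lambda>n. recip_enat (pierce_digit (Suc n) x))}"

definition T_div :: "real set" where
  "T_div = {x \<in> {0..1}. \<not> summable (\<lambda>n. (pierce_T ^^ Suc n) x)}"

section \<open>Hausdorff measure and dimension\<close>

text \<open>
  The t-th power of the diameter, with the usual conventions that the empty set always
  contributes 0 and that a non-empty set contributes 1 when t = 0
  (note that \<open>0 powr 0 = 0\<close> in HOL).
\<close>

definition diam_pow :: "real \<Rightarrow> 'a::metric_space set \<Rightarrow> ennreal" where
  "diam_pow t U = (if U = {} then 0 else if t = 0 then 1 else ennreal (diameter U powr t))"

text \<open>
  Finite covers are included, as countable covers padded with empty sets. Boundedness
  is required explicitly because \<open>diameter\<close> is unspecified on unbounded sets.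
\<close>

definition hausdorff_premeasure :: "real \<Rightarrow> real \<Rightarrow> 'a::metric_space set \<Rightarrow> ennreal" where
  "hausdorff_premeasure t \<delta> F =
     Inf {(\<Sum>i. diam_pow t (U i)) | U :: nat \<Rightarrow> 'a set.
            F \<subseteq> (\<Union>i. U i) \<and> (\<forall>i. bounded (U i) \<and> diameter (U i) \<le> \<delta>)}"

definition hausdorff_measure :: "real \<Rightarrow> 'a::metric_space set \<Rightarrow> ennreal" where
  "hausdorff_measure t F = (SUP \<delta>\<in>{0<..}. hausdorff_premeasure t \<delta> F)"

text \<open>Taken in \<open>ennreal\<close>, so that the infimum of the empty set is \<open>\<infinity>\<close>.\<close>

definition hausdorff_dim :: "'a::metric_space set \<Rightarrow> ennreal" where
  "hausdorff_dim F = Inf {ennreal t | t. 0 \<le> t \<and> hausdorff_measure t F = 0}"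

end

theory Submission
  imports Defs "HOL-Real_Asymp.Real_Asymp"
begin

text \<open>
  Pierce digits are strictly increasing, and a point is recovered from \<open>n\<close> digits and
  its \<open>n\<close>-th iterate through \<open>x = (1 - T(x)) / d\<^sub>1(x)\<close>. Hence two points with the same first
  \<open>n\<close> digits are at distance at most \<open>1 / (d\<^sub>1 \<cdots> d\<^sub>n) \<le> 1 / n!\<close>. If \<open>\<Sum> 1 / d\<^sub>n\<close> diverges,
  then, for each \<open>\<epsilon> > 0\<close>, \<open>d\<^sub>n < n\<^bsup>1 + \<epsilon>\<^esup>\<close> holds for infinitely many \<open>n\<close>. For such an \<open>n\<close> the first
  \<open>n\<close> digits form an \<open>n\<close>-element subset of \<open>{1..n\<^bsup>1 + \<epsilon>\<^esup>}\<close>, and that subset determines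
  the digits because they increase. There are at most \<open>n\<^bsup>(1 + \<epsilon>) n\<^esup> / n!\<close> such subsets, which,
  up to factors exponential in \<open>n\<close>, is \<open>n\<^bsup>\<epsilon> n\<^esup>\<close>, while the \<open>t\<close>-th power of each diameter is at most \<open>n\<^bsup>- t n\<^esup>\<close>. With
  \<open>\<epsilon> = t / 2\<close> the products are summable, so the covers by the tails show that the
  \<open>t\<close>-dimensional Hausdorff measure vanishes (\<open>hausdorff_measure_limsup_eq_0\<close>).

  The statement for the iterates follows by comparison, since \<open>T\<^sup>n(x) \<le> 1 / d\<^sub>n\<^sub>+\<^sub>1(x)\<close> gives
  \<open>T_div \<subseteq> D_div\<close>.
\<close>

section \<open>Hausdorff measure of limit superior sets\<close>

text \<open>
  The Hausdorff form of the Borel-Cantelli lemma: the families of index at least \<open>N\<close>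
  together cover \<open>F\<close>, and their total \<open>t\<close>-content is a tail of a convergent series.
\<close>

lemma hausdorff_measure_limsup_eq_0:
  fixes F :: "'a::metric_space set" and \<C> :: "nat \<Rightarrow> 'a set set" and r :: "nat \<Rightarrow> real"
  assumes t: "0 < t"
    and fin: "\<And>n. finite (\<C> n)"
    and bdd: "\<And>n U. U \<in> \<C> n \<Longrightarrow> bounded U"
    and diam: "\<And>n U. U \<in> \<C> n \<Longrightarrow> diameter U \<le> r n"
    and r0: "r \<longlonglongrightarrow> 0"
    and summ: "summable (\<lambda>n. real (card (\<C> n)) * r n powr t)"
    and freq: "\<And>x. x \<in> F \<Longrightarrow> \<exists>\<^sub>F n in sequentially. x \<in> \<Union>(\<C> n)"
  shows "hausdorff_measure t F = 0"
proof -
  have "hausdorff_premeasure t \<delta> F \<le> 0" if \<delta>: "0 < \<delta>" for \<delta>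
  proof (rule ennreal_le_epsilon)
    fix e :: real assume e: "0 < e"
    let ?c = "\<lambda>n. real (card (\<C> n)) * r n powr t"
    obtain N1 where N1: "\<And>n. n \<ge> N1 \<Longrightarrow> norm (\<Sum>i. ?c (i + n)) < e"
      using suminf_exist_split[OF e summ] by blast
    obtain N2 where N2: "\<And>n. n \<ge> N2 \<Longrightarrow> r n < \<delta>"
      using order_tendstoD(2)[OF r0 \<delta>] by (auto simp: eventually_sequentially)
    define N where "N = max N1 N2"
    have "\<forall>n. \<exists>h. bij_betw h {0..<card (\<C> n)} (\<C> n)"
      using ex_bij_betw_nat_finite[OF fin] by blast
    then obtain h where h: "\<And>n. bij_betw (h n) {0..<card (\<C> n)} (\<C> n)"
      by metis
    define V where "V n j = (if j < card (\<C> (n + N)) then h (n + N) j else {})" for n j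
    have V_mem: "V n j \<in> \<C> (n + N)" if "j < card (\<C> (n + N))" for n j
      using that h[of "n + N"] by (auto simp: V_def bij_betw_def)
    define W where "W k = (case prod_decode k of (n, j) \<Rightarrow> V n j)" for k
    have V_ok: "bounded (V n j) \<and> diameter (V n j) \<le> \<delta>" for n j
    proof (cases "j < card (\<C> (n + N))")
      case True
      have "r (n + N) < \<delta>" by (rule N2) (simp add: N_def)
      then show ?thesis using bdd[OF V_mem[OF True]] diam[OF V_mem[OF True]] by simp
    next
      case False
      then show ?thesis using \<delta> by (simp add: V_def)
    qed
    have cover: "F \<subseteq> (\<Union>k. W k)"
    proof
      fix x assume "x \<in> F"
      then obtain n where n: "n \<ge> N" "x \<in> \<Union>(\<C> n)"
        using freq unfolding frequently_sequentially by meson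
      then obtain U where U: "U \<in> \<C> n" "x \<in> U" by blast
      have "U \<in> h n ` {0..<card (\<C> n)}"
        using U(1) bij_betw_imp_surj_on[OF h[of n]] by simp
      then obtain j where j: "j < card (\<C> n)" "h n j = U" by auto
      have "W (prod_encode (n - N, j)) = U"
        using j n by (simp add: W_def V_def)
      then show "x \<in> (\<Union>k. W k)" using U by blast
    qed
    have V_pow: "diam_pow t (V n j) \<le> ennreal (r (n + N) powr t)"
      if "j < card (\<C> (n + N))" for n j
      using that t bdd[OF V_mem[OF that]] diam[OF V_mem[OF that]]
      by (auto simp: diam_pow_def intro!: ennreal_leI powr_mono2 diameter_ge_0)
    have row: "(\<Sum>j. diam_pow t (V n j)) \<le> ennreal (?c (n + N))" for n
    proof -
      have "(\<Sum>j. diam_pow t (V n j)) = (\<Sum>j<card (\<C> (n + N)). diam_pow t (V n j))"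
        by (rule suminf_finite) (auto simp: V_def diam_pow_def)
      also have "\<dots> \<le> (\<Sum>j<card (\<C> (n + N)). ennreal (r (n + N) powr t))"
        by (intro sum_mono V_pow) auto
      also have "\<dots> = ennreal (?c (n + N))"
        by (simp add: ennreal_mult ennreal_of_nat_eq_real_of_nat)
      finally show ?thesis .
    qed
    have "hausdorff_premeasure t \<delta> F \<le> (\<Sum>k. diam_pow t (W k))"
      unfolding hausdorff_premeasure_def
    proof (rule Inf_lower, rule CollectI, intro exI conjI allI)
      show "F \<subseteq> (\<Union>k. W k)" by (rule cover)
      show "bounded (W k)" "diameter (W k) \<le> \<delta>" for k
        using V_ok by (auto simp: W_def split: prod.split)
    qed simp
    also have "\<dots> = (\<Sum>k. (case_prod (\<lambda>n j. diam_pow t (V n j)) \<circ> prod_decode) k)"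
      by (simp add: W_def o_def case_prod_beta)
    also have "\<dots> = (\<Sum>n. \<Sum>j. diam_pow t (V n j))"
      unfolding o_def by (rule suminf_ennreal_2dimen) simp
    also have "\<dots> \<le> (\<Sum>n. ennreal (?c (n + N)))"
      by (intro suminf_le row) auto
    also have "\<dots> = ennreal (\<Sum>n. ?c (n + N))"
      by (intro suminf_ennreal2) (use summ in \<open>auto simp: summable_iff_shift[of ?c N]\<close>)
    also have "\<dots> \<le> ennreal e"
      using N1[of N] by (intro ennreal_leI) (auto simp: N_def)
    finally show "hausdorff_premeasure t \<delta> F \<le> 0 + ennreal e" by simp
  qed
  then show ?thesis
    by (auto simp: hausdorff_measure_def intro!: antisym SUP_least)
qed

lemma hausdorff_dim_eq_0I:
  assumes "\<And>t. 0 < t \<Longrightarrow> hausdorff_measure t F = 0"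
  shows "hausdorff_dim F = 0"
proof -
  have "hausdorff_dim F \<le> 0"
  proof (rule ennreal_le_epsilon)
    fix e :: real assume "0 < e"
    then have "hausdorff_dim F \<le> ennreal e"
      unfolding hausdorff_dim_def using assms[of e] by (intro Inf_lower) auto
    then show "hausdorff_dim F \<le> 0 + ennreal e" by simp
  qed
  then show ?thesis by simp
qed

section \<open>Pierce digits as natural numbers\<close>

text \<open>
  The numbering starts at 0, so \<open>dig k x\<close> is the \<open>(k + 1)\<close>-st Pierce digit. An infinite digit
  is encoded as 0, which agrees with \<open>1 / \<infinity> = 0\<close> because \<open>1 / 0 = 0\<close> in HOL.
\<close>

definition dig :: "nat \<Rightarrow> real \<Rightarrow> nat" where
  "dig k x = nat \<lfloor>1 / (pierce_T ^^ k) x\<rfloor>"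

lemma recip_pierce_digit: "recip_enat (pierce_digit (Suc k) x) = 1 / real (dig k x)"
  by (simp add: recip_enat_def pierce_digit_def pierce_d1_def dig_def)

lemma pierce_T_funpow_Suc:
  "(pierce_T ^^ k) x \<noteq> 0 \<Longrightarrow>
    (pierce_T ^^ Suc k) x = 1 - real (dig k x) * (pierce_T ^^ k) x"
  by (simp add: pierce_T_def pierce_d1_def dig_def)

lemma floor_inverse_bounds:
  fixes x :: real
  assumes "0 < x" "x \<le> 1"
  defines "d \<equiv> nat \<lfloor>1 / x\<rfloor>"
  shows "1 \<le> d" "real d * x \<le> 1" "1 < (real d + 1) * x"
proof -
  have ge: "1 \<le> 1 / x" using assms by simp
  then have floor_ge: "1 \<le> \<lfloor>1 / x\<rfloor>" by (simp only: le_floor_iff of_int_1)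
  then show "1 \<le> d" unfolding d_def by linarith
  have d: "real d = of_int \<lfloor>1 / x\<rfloor>"
    using floor_ge unfolding d_def by (intro of_nat_nat) linarith
  have "real d \<le> 1 / x" "1 / x < real d + 1" unfolding d by linarith+
  then show "real d * x \<le> 1" "1 < (real d + 1) * x"
    using assms(1) by (simp_all add: field_simps)
qed

lemma pierce_T_in_unit: "x \<in> {0..1} \<Longrightarrow> pierce_T x \<in> {0..1}"
  using floor_inverse_bounds[of x]
  by (auto simp: pierce_T_def pierce_d1_def)

lemma pierce_T_funpow_in_unit: "x \<in> {0..1} \<Longrightarrow> (pierce_T ^^ k) x \<in> {0..1}"
  by (induction k) (use pierce_T_in_unit in auto)

lemma pierce_T_funpow_zero_mono:
  assumes "(pierce_T ^^ j) x = 0" "j \<le> k"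
  shows "(pierce_T ^^ k) x = 0"
  using assms(2)
proof (induction k rule: dec_induct)
  case base
  show ?case by (rule assms(1))
next
  case (step k)
  then show ?case by (simp add: pierce_T_def)
qed

text \<open>From \<open>1 < (d + 1) y\<close>, the next iterate \<open>1 - d y\<close> is smaller than \<open>1 / (d + 1)\<close>.\<close>

lemma dig_less_dig_Suc:
  assumes x: "x \<in> {0..1}" and nz: "(pierce_T ^^ Suc k) x \<noteq> 0"
  shows "dig k x < dig (Suc k) x"
proof -
  define y where "y = (pierce_T ^^ k) x"
  define z where "z = (pierce_T ^^ Suc k) x"
  define d where "d = dig k x"
  have "y \<noteq> 0" using pierce_T_funpow_zero_mono[of k x "Suc k"] nz by (auto simp: y_def)
  then have y: "0 < y" "y \<le> 1" and z: "0 < z"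
    using pierce_T_funpow_in_unit[OF x, of k] pierce_T_funpow_in_unit[OF x, of "Suc k"] nz
    unfolding y_def z_def by (auto simp del: funpow.simps)
  have zy: "z = 1 - real d * y"
    using pierce_T_funpow_Suc[of k x] \<open>y \<noteq> 0\<close> by (simp add: y_def z_def d_def)
  have "1 < (real d + 1) * y"
    using floor_inverse_bounds(3)[OF y] by (simp add: d_def dig_def y_def)
  then have "real d * 1 \<le> real d * ((real d + 1) * y)"
    by (intro mult_left_mono) auto
  then have "(real d + 1) * z \<le> 1"
    unfolding zy by (simp add: algebra_simps)
  then have "real d + 1 \<le> 1 / z"
    using z by (simp add: field_simps)
  then have "int d + 1 \<le> \<lfloor>1 / z\<rfloor>" by (simp add: le_floor_iff)
  then show ?thesis by (simp add: dig_def[of "Suc k"] d_def[symmetric] z_def)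
qed

lemma dig_strict_mono:
  assumes x: "x \<in> {0..1}" and "(pierce_T ^^ k) x \<noteq> 0" "j < k"
  shows "dig j x < dig k x"
  using assms(3,2)
proof (induction k rule: less_Suc_induct)
  case (1 i)
  then show ?case using dig_less_dig_Suc[OF x] by blast
next
  case (2 i j k)
  then show ?case using pierce_T_funpow_zero_mono[of j x k] by force
qed

lemma Suc_le_dig:
  assumes x: "x \<in> {0..1}" and "(pierce_T ^^ k) x \<noteq> 0"
  shows "Suc k \<le> dig k x"
  using assms(2)
proof (induction k)
  case 0
  then show ?case using floor_inverse_bounds(1)[of x] x by (simp add: dig_def)
next
  case (Suc k)
  then have "(pierce_T ^^ k) x \<noteq> 0" using pierce_T_funpow_zero_mono[of k x "Suc k"] by force
  with Suc.IH dig_less_dig_Suc[OF x Suc.prems] show ?case by simp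
qed

lemma pierce_T_funpow_le:
  assumes "x \<in> {0..1}"
  shows "(pierce_T ^^ k) x \<le> 1 / real (dig k x)"
proof (cases "(pierce_T ^^ k) x = 0")
  case False
  then show ?thesis
    using floor_inverse_bounds(1,2)[of "(pierce_T ^^ k) x"] pierce_T_funpow_in_unit[OF assms, of k]
    by (simp add: dig_def field_simps)
qed simp

section \<open>Cylinders\<close>

text \<open>
  The digits increase, so a cylinder may be indexed by the set of its digits
  instead of the sequence; counting cylinders then amounts to counting subsets.
\<close>

definition cylinder :: "nat set \<Rightarrow> real set" where
  "cylinder S = {x \<in> {0..1}. (\<forall>k < card S. (pierce_T ^^ k) x \<noteq> 0) \<and>
                             (\<lambda>k. dig k x) ` {..<card S} = S}"

lemma cylinder_dig_eq:
  assumes "x \<in> cylinder S" "y \<in> cylinder S" "k < card S"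
  shows "dig k x = dig k y"
proof -
  have list: "map (\<lambda>k. dig k z) [0..<card S] = sorted_list_of_set S" if z: "z \<in> cylinder S" for z
  proof -
    have "sorted_wrt (<) (map (\<lambda>k. dig k z) [0..<card S])"
      using z by (auto simp: cylinder_def sorted_wrt_iff_nth_less intro!: dig_strict_mono)
    moreover have "set (map (\<lambda>k. dig k z) [0..<card S]) = S"
      using z by (auto simp: cylinder_def atLeast0LessThan)
    ultimately show ?thesis
      by (metis sorted_list_of_set.idem_if_sorted_distinct strict_sorted_iff)
  qed
  have "map (\<lambda>k. dig k x) [0..<card S] ! k = map (\<lambda>k. dig k y) [0..<card S] ! k"
    using list assms by simp
  then show ?thesis using assms(3) by simp
qed

text \<open>Each application of \<open>T\<close> to points sharing a digit \<open>d\<close> multiplies their distance by \<open>d\<close>.\<close>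

lemma dist_funpow_same_digits:
  assumes "\<And>k. k < n \<Longrightarrow> (pierce_T ^^ k) x \<noteq> 0" "\<And>k. k < n \<Longrightarrow> (pierce_T ^^ k) y \<noteq> 0"
    and "\<And>k. k < n \<Longrightarrow> dig k x = dig k y"
  shows "dist ((pierce_T ^^ n) x) ((pierce_T ^^ n) y) = (\<Prod>k<n. real (dig k x)) * dist x y"
  using assms
proof (induction n)
  case (Suc n)
  have "dist ((pierce_T ^^ Suc n) x) ((pierce_T ^^ Suc n) y)
      = real (dig n x) * dist ((pierce_T ^^ n) x) ((pierce_T ^^ n) y)"
    using pierce_T_funpow_Suc[of n x] pierce_T_funpow_Suc[of n y] Suc.prems[of n]
    by (simp add: dist_real_def abs_mult abs_minus_commute flip: right_diff_distrib)
  with Suc show ?case by simp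
qed simp

lemma bounded_cylinder: "bounded (cylinder S)"
  by (rule bounded_subset[of "{0..1}"]) (auto simp: cylinder_def)

lemma diameter_cylinder_le: "diameter (cylinder S) \<le> 1 / fact (card S)"
proof (cases "cylinder S = {}")
  case False
  show ?thesis
  proof (rule diameter_le)
    fix x y assume xy: "x \<in> cylinder S" "y \<in> cylinder S"
    let ?n = "card S"
    have "(fact ?n :: real) = (\<Prod>k<?n. real (Suc k))"
      by (simp add: fact_prod_Suc lessThan_atLeast0)
    also have "\<dots> \<le> (\<Prod>k<?n. real (dig k x))"
      using xy(1) by (intro prod_mono) (auto simp: cylinder_def simp del: of_nat_Suc intro!: Suc_le_dig)
    finally have "fact ?n * dist x y \<le> (\<Prod>k<?n. real (dig k x)) * dist x y"
      by (intro mult_right_mono) auto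
    also have "\<dots> = dist ((pierce_T ^^ ?n) x) ((pierce_T ^^ ?n) y)"
      using xy cylinder_dig_eq[OF xy]
      by (intro dist_funpow_same_digits[symmetric]) (auto simp: cylinder_def)
    also have "\<dots> \<le> 1"
      using pierce_T_funpow_in_unit[of x ?n] pierce_T_funpow_in_unit[of y ?n] xy
      by (auto simp: cylinder_def dist_real_def)
    finally show "norm (x - y) \<le> 1 / fact ?n"
      by (simp add: field_simps dist_norm)
  qed (use False in auto)
qed simp

section \<open>Points with infinitely many small digits\<close>

text \<open>The index set of the cylinders of rank \<open>n\<close> with largest digit at most \<open>n\<^bsup>s\<^esup>\<close>.\<close>

definition small_digit_sets :: "real \<Rightarrow> nat \<Rightarrow> nat set set" where
  "small_digit_sets s n = {S. S \<subseteq> {1..nat \<lfloor>real n powr s\<rfloor>} \<and> card S = n}"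

lemma finite_small_digit_sets: "finite (small_digit_sets s n)"
  by (rule finite_subset[of _ "Pow {1..nat \<lfloor>real n powr s\<rfloor>}"]) (auto simp: small_digit_sets_def)

lemma power_self_le_exp_mult_fact: "real n ^ n \<le> exp (real n) * fact n"
proof -
  have "real n ^ n /\<^sub>R fact n \<le> exp (real n)"
    unfolding exp_def
    by (rule order_trans[OF _ sum_le_suminf[OF summable_exp_generic, of "{n}"]]) auto
  then show ?thesis by (simp add: field_simps)
qed

text \<open>
  Combines \<open>card \<le> n\<^bsup>(1 + \<epsilon>) n\<^esup> / n!\<close> with \<open>1 / n! \<le> (e / n)\<^sup>n\<close>; the latter is used twice,
  for the count and for the diameter.
\<close>

lemma small_digit_sets_content:
  assumes n: "0 < n" and t: "0 < t"
  shows "real (card (small_digit_sets (1 + \<epsilon>) n)) * (1 / fact n) powr t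
           \<le> exp (real n * (1 + t - (t - \<epsilon>) * ln (real n)))"
proof -
  define M where "M = nat \<lfloor>real n powr (1 + \<epsilon>)\<rfloor>"
  have inv_fact: "1 / fact n \<le> exp (real n * (1 - ln (real n)))"
  proof -
    have "exp (real n * ln (real n)) = real n ^ n"
      using n by (simp add: exp_of_nat_mult)
    then show ?thesis
      using power_self_le_exp_mult_fact[of n] n
      by (simp add: right_diff_distrib exp_diff field_simps)
  qed
  have "card (small_digit_sets (1 + \<epsilon>) n) = M choose n"
    using n_subsets[of "{1..M}" n] by (simp add: small_digit_sets_def M_def)
  moreover have "real ((M choose n) * fact n) \<le> real (M ^ n)"
    using binomial_fact_pow[of M n] by (simp only: of_nat_le_iff)
  ultimately have "real (card (small_digit_sets (1 + \<epsilon>) n)) \<le> real M ^ n * (1 / fact n)"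
    by (simp add: field_simps)
  also have "\<dots> \<le> (real n powr (1 + \<epsilon>)) ^ n * (1 / fact n)"
    by (intro mult_right_mono power_mono) (simp_all add: M_def)
  also have "(real n powr (1 + \<epsilon>)) ^ n = exp (real n * ((1 + \<epsilon>) * ln (real n)))"
    using n by (simp add: powr_def exp_of_nat_mult)
  also have "exp (real n * ((1 + \<epsilon>) * ln (real n))) * (1 / fact n)
      \<le> exp (real n * ((1 + \<epsilon>) * ln (real n))) * exp (real n * (1 - ln (real n)))"
    by (intro mult_left_mono inv_fact) auto
  finally have count: "real (card (small_digit_sets (1 + \<epsilon>) n)) \<le> \<dots>" .
  have "(1 / fact n) powr t \<le> exp (real n * (1 - ln (real n))) powr t"
    using t by (intro powr_mono2 inv_fact) auto
  also have "\<dots> = exp (t * (real n * (1 - ln (real n))))" by (simp add: powr_def)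
  finally have "real (card (small_digit_sets (1 + \<epsilon>) n)) * (1 / fact n) powr t
      \<le> (exp (real n * ((1 + \<epsilon>) * ln (real n))) * exp (real n * (1 - ln (real n)))) *
          exp (t * (real n * (1 - ln (real n))))"
    by (intro mult_mono count) auto
  also have "\<dots> = exp (real n * (1 + t - (t - \<epsilon>) * ln (real n)))"
    by (simp add: algebra_simps flip: exp_add)
  finally show ?thesis .
qed

text \<open>
  With \<open>\<epsilon> = t / 2\<close> the coefficient of \<open>ln n\<close> in the exponent is negative, which eventually beats
  the constant \<open>1 + t\<close>; a geometric series then dominates.
\<close>

lemma summable_small_digit_sets_content:
  assumes t: "0 < t"
  shows "summable (\<lambda>n. real (card (small_digit_sets (1 + t / 2) n)) * (1 / fact n) powr t)"
proof (rule summable_comparison_test_ev)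
  show "summable (\<lambda>n. exp (- 1 :: real) ^ n)" by (rule summable_geometric) simp
  have "\<forall>\<^sub>F n in sequentially. 1 + t - (t - t / 2) * ln (real n) \<le> - 1"
    using t by real_asymp
  then show "\<forall>\<^sub>F n in sequentially.
      norm (real (card (small_digit_sets (1 + t / 2) n)) * (1 / fact n) powr t) \<le> exp (- 1) ^ n"
    using eventually_gt_at_top[of 0]
  proof eventually_elim
    case (elim n)
    have "real n * (1 + t - (t - t / 2) * ln (real n)) \<le> real n * - 1"
      using elim by (intro mult_left_mono) auto
    then have "exp (real n * (1 + t - (t - t / 2) * ln (real n))) \<le> exp (- 1) ^ n"
      unfolding exp_of_nat_mult[symmetric] by simp
    then show ?case using small_digit_sets_content[OF elim(2) t, of "t / 2"] by simp
  qed
qed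

text \<open>
  The \<open>n\<close>-th digit is below \<open>n\<^bsup>s\<^esup>\<close> infinitely often, since otherwise \<open>1 / d\<^sub>n\<close> would eventually
  be dominated by \<open>n\<^bsup>- s\<^esup>\<close>; the earlier digits are smaller still. The expansion of the point is infinite,
  as a finite one leads to a finite sum.
\<close>

lemma D_div_frequently_in_cylinder:
  assumes x: "x \<in> D_div" and s: "1 < s"
  shows "\<exists>\<^sub>F n in sequentially. x \<in> \<Union>(cylinder ` small_digit_sets s n)"
proof -
  have x01: "x \<in> {0..1}" and div: "\<not> summable (\<lambda>k. 1 / real (dig k x))"
    using x by (auto simp: D_div_def recip_pierce_digit)
  have nz: "(pierce_T ^^ k) x \<noteq> 0" for k
  proof
    assume zero: "(pierce_T ^^ k) x = 0"
    have "summable (\<lambda>j. 1 / real (dig j x))"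
      by (rule summable_finite[of "{..<k}"])
         (use pierce_T_funpow_zero_mono[OF zero] in \<open>auto simp: dig_def not_less\<close>)
    with div show False by contradiction
  qed
  have "\<exists>\<^sub>F k in sequentially. real (dig k x) < real (Suc k) powr s"
  proof (rule ccontr)
    assume "\<not> ?thesis"
    then have ev: "\<forall>\<^sub>F k in sequentially. real (Suc k) powr s \<le> real (dig k x)"
      by (simp add: not_frequently not_less)
    have "summable (\<lambda>k. real (Suc k) powr - s)"
      using s by (subst summable_Suc_iff) (simp add: summable_real_powr_iff)
    moreover have "\<forall>\<^sub>F k in sequentially. norm (1 / real (dig k x)) \<le> real (Suc k) powr - s"
      using ev
    proof eventually_elim
      case (elim k)
      have "0 < real (Suc k) powr s" by simp
      then have "1 / real (dig k x) \<le> 1 / real (Suc k) powr s"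
        using elim by (intro frac_le) auto
      then show ?case by (simp add: powr_minus_divide)
    qed
    ultimately have "summable (\<lambda>k. 1 / real (dig k x))"
      by (rule summable_comparison_test_ev[rotated])
    with div show False by contradiction
  qed
  then have "\<exists>\<^sub>F k in sequentially. x \<in> \<Union>(cylinder ` small_digit_sets s (Suc k))"
  proof (rule frequently_elim1)
    fix k assume k: "real (dig k x) < real (Suc k) powr s"
    define S where "S = (\<lambda>j. dig j x) ` {..<Suc k}"
    have mono: "strict_mono (\<lambda>j. dig j x)"
      using dig_strict_mono[OF x01 nz] by (auto simp: strict_mono_def)
    then have card: "card S = Suc k"
      unfolding S_def by (subst card_image) (auto intro: inj_on_subset strict_mono_imp_inj_on)
    have "dig j x \<in> {1..nat \<lfloor>real (Suc k) powr s\<rfloor>}" if "j < Suc k" for j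
    proof -
      have "dig j x \<le> dig k x" using that strict_mono_less_eq[OF mono, of j k] by simp
      with k have "real (dig j x) \<le> real (Suc k) powr s" by linarith
      then have "dig j x \<le> nat \<lfloor>real (Suc k) powr s\<rfloor>" by (simp add: le_nat_floor)
      then show ?thesis using Suc_le_dig[OF x01 nz, of j] by simp
    qed
    then have "S \<in> small_digit_sets s (Suc k)"
      using card by (auto simp: S_def small_digit_sets_def)
    moreover have "x \<in> cylinder S"
      using x01 nz card by (auto simp: cylinder_def S_def)
    ultimately show "x \<in> \<Union>(cylinder ` small_digit_sets s (Suc k))" by blast
  qed
  then show ?thesis
    unfolding frequently_sequentially by (meson le_SucI)
qed

lemma hausdorff_measure_subset_D_div:
  assumes t: "0 < t" and F: "F \<subseteq> D_div"
  shows "hausdorff_measure t F = 0"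
proof (rule hausdorff_measure_limsup_eq_0[OF t])
  let ?C = "\<lambda>n. cylinder ` small_digit_sets (1 + t / 2) n"
  show "finite (?C n)" for n using finite_small_digit_sets by blast
  show "bounded U" if "U \<in> ?C n" for n U using that bounded_cylinder by blast
  show "diameter U \<le> 1 / fact n" if "U \<in> ?C n" for n U
    using that diameter_cylinder_le by (auto simp: small_digit_sets_def)
  show "(\<lambda>n. 1 / fact n :: real) \<longlonglongrightarrow> 0"
    using summable_LIMSEQ_zero[OF summable_exp[of "1 :: real"]] by (simp add: inverse_eq_divide)
  show "summable (\<lambda>n. real (card (?C n)) * (1 / fact n) powr t)"
    by (rule summable_comparison_test'[OF summable_small_digit_sets_content[OF t], of 0])
       (auto intro!: mult_right_mono card_image_le finite_small_digit_sets)
  show "\<exists>\<^sub>F n in sequentially. x \<in> \<Union>(?C n)" if "x \<in> F" for x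
    using that F t by (intro D_div_frequently_in_cylinder) auto
qed

lemma T_div_subset_D_div: "T_div \<subseteq> D_div"
proof
  fix x assume x: "x \<in> T_div"
  then have x01: "x \<in> {0..1}" and div: "\<not> summable (\<lambda>n. (pierce_T ^^ Suc n) x)"
    by (auto simp: T_div_def)
  have "\<not> summable (\<lambda>k. 1 / real (dig k x))"
  proof
    assume "summable (\<lambda>k. 1 / real (dig k x))"
    then have "summable (\<lambda>k. (pierce_T ^^ k) x)"
      by (rule summable_comparison_test'[where N = 0])
         (use pierce_T_funpow_le[OF x01] pierce_T_funpow_in_unit[OF x01] in auto)
    then show False using div by (subst (asm) summable_Suc_iff[symmetric]) simp
  qed
  then show "x \<in> D_div" using x01 by (simp add: D_div_def recip_pierce_digit)
qed

theorem corollary1p15: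
  shows "hausdorff_dim D_div = 0 \<and> hausdorff_dim T_div = 0"
  using hausdorff_measure_subset_D_div T_div_subset_D_div
  by (blast intro: hausdorff_dim_eq_0I)

end
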